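(* Let $M,\gamma,k,N>0$, $b>0$ and $a\in\mathbb{R}$. Define the service provider's expected utility as a function of the data size $q\in[0,N]$ by $$G(q)=\begin{cases}0 & q=0,\\[2pt] \dfrac{M\gamma\,(a+b\ln q)}{4}-kq & q>0.\end{cases}$$ Then there exists a globally optimal data size $q^{*}\in[0,N]$ that maximizes $G$ over $[0,N]$, i.e. $G(q^{*})\ge G(q)$ for all $q\in[0,N]$.
   Context: Here $M$ is the number of customers of a big data service, $\gamma$ is the influence coefficient of service performance on customer valuation, $k$ is the cost of one data unit, $N$ is the maximal available number of data units ($q$ is treated as a continuous variable), and $r(q)=a+b\ln q$ is the (monotone increasing) service performance obtained from $q$ data units. The function $G$ is the expected profit when the service is sold at price $p^*=\gamma r(q)/2$ to customers with i.i.d. valuations uniform on $[0,\gamma r(q)]$, minus the data cost $kq$; $q=0$ means no data is bought. *)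

theory Defs
  imports Complex_Main
begin

definition service_performance :: "real \<Rightarrow> real \<Rightarrow> real \<Rightarrow> real" where
  "service_performance a b q = a + b * ln q"

(* The first branch is essential: Isabelle's ln 0 is a junk value, and the formula
   for q > 0 diverges to minus infinity as q tends to 0. Negative q is never used. *)
definition expected_utility ::
    "real \<Rightarrow> real \<Rightarrow> real \<Rightarrow> real \<Rightarrow> real \<Rightarrow> real \<Rightarrow> real" where
  "expected_utility M \<gamma> k a b q =
     (if q = 0 then 0 else M * \<gamma> * service_performance a b q / 4 - k * q)"

end

theory Submission
  imports Defs
begin

text \<open>For \<open>q > 0\<close> the utility is, up to a constant, the concave function \<open>c * ln q - k * q\<close> with
  \<open>c = M * \<gamma> * b / 4\<close>, whose stationary point is \<open>c / k\<close>. Hence its maximum over \<open>{0<..N}\<close> is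
  attained at \<open>min N (c / k)\<close>, and the better of this point and \<open>0\<close> is globally optimal.\<close>

lemma ln_minus_linear_le_at_min:
  fixes c k N q :: real
  assumes "c > 0" "k > 0" "0 < q" "q \<le> N"
  defines "s \<equiv> min N (c / k)"
  shows "c * ln q - k * q \<le> c * ln s - k * s"
proof -
  have s: "s > 0" using assms by (simp add: s_def)
  \<comment> \<open>By concavity, \<open>ln\<close> lies below its tangent at
    \<open>s\<close>.\<close>
  have "ln q - ln s \<le> (q - s) / s"
    using ln_le_minus_one[of "q / s"] s \<open>0 < q\<close> by (simp add: ln_div diff_divide_distrib)
  then have "c * (ln q - ln s) \<le> c * ((q - s) / s)"
    using \<open>c > 0\<close> by (intro mult_left_mono) auto
  also have "\<dots> = c / s * (q - s)" by simp
  \<comment> \<open>The slope \<open>c / s - k\<close> of the objective at \<open>s\<close> is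
    nonnegative if \<open>s = N\<close>, where \<open>q - s \<le> 0\<close>, and zero if
    \<open>s = c / k\<close>.\<close>
  also have "\<dots> \<le> k * (q - s)"
  proof (cases "N \<le> c / k")
    case True
    then have "s = N" by (simp add: s_def)
    with True have "k \<le> c / s" using s \<open>k > 0\<close> by (simp add: field_simps)
    then show ?thesis using \<open>q \<le> N\<close> \<open>s = N\<close> by (intro mult_right_mono_neg) auto
  next
    case False
    then have "s = c / k" by (simp add: s_def)
    then have "c / s = k" using assms(1,2) by simp
    then show ?thesis by simp
  qed
  finally show ?thesis by (simp add: algebra_simps)
qed

theorem proposition3:
  fixes M \<gamma> k N a b :: real
  assumes "M > 0" and "\<gamma> > 0" and "k > 0" and "N > 0" and "b > 0"
  shows "\<exists>q_opt \<in> {0..N}. \<forall>q \<in> {0..N}.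
           expected_utility M \<gamma> k a b q_opt \<ge> expected_utility M \<gamma> k a b q"
proof -
  let ?G = "expected_utility M \<gamma> k a b"
  define c where "c = M * \<gamma> * b / 4"
  define s where "s = min N (c / k)"
  have c: "c > 0" using assms by (simp add: c_def)
  have s: "0 < s" "s \<le> N" using c assms by (auto simp: s_def)
  have G: "?G q = M * \<gamma> * a / 4 + (c * ln q - k * q)" if "q > 0" for q
    using that by (simp add: expected_utility_def service_performance_def c_def field_simps)
  have le: "?G q \<le> max (?G 0) (?G s)" if "q \<in> {0..N}" for q
  proof (cases "q = 0")
    case False
    with that have "0 < q" "q \<le> N" by auto
    then have "?G q \<le> ?G s"
      using ln_minus_linear_le_at_min[OF c \<open>k > 0\<close>, of q N] s by (simp add: G s_def)
    then show ?thesis by simp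
  qed simp
  show ?thesis
  \<comment> \<open>Since \<open>?G 0 = 0\<close>, the sign of \<open>?G s\<close> decides between
    the two candidates; either sign can occur, depending on \<open>a\<close>.\<close>
  proof (cases "?G 0 \<le> ?G s")
    case True
    with le s show ?thesis by (intro bexI[of _ s]) (auto simp: max_def)
  next
    case False
    with le \<open>N > 0\<close> show ?thesis by (intro bexI[of _ 0]) (auto simp: max_def)
  qed
qed

end
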